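(* For $i\in\{1,2,3\}$ the following sum is direct: $$P=\sum_{N\in\mathbb N}\sum_{\ell\in\mathbb N}R_i^\ell\bigl({\rm Ker}(L_i)\cap P_N\bigr).$$
   Context: $\mathbb N=\{0,1,2,\ldots\}$. $P=\mathbb C[x,y,z,w]$; $P_N$ is the subspace of homogeneous polynomials of total degree $N$. With $D_x,D_y,D_z,D_w$ the partial derivatives, define $L_i,R_i\in{\rm End}(P)$ by $L_1=D_xD_y-D_zD_w$, $L_2=D_xD_z-D_wD_y$, $L_3=D_xD_w-D_yD_z$; $R_1(f)=(xy-zw)f$, $R_2(f)=(xz-wy)f$, $R_3(f)=(xw-yz)f$. *)

theory Defs
  imports Complex_Main "HOL-Library.Poly_Mapping"
begin

text \<open>
  The polynomial algebra \<open>P = \<complex>[x,y,z,w]\<close>: finitely supported maps from monomials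
  (exponent vectors) to coefficients, with the convolution product of Poly_Mapping.
  \<open>P\<close> is the whole type.
\<close>

datatype var = X | Y | Z | W

type_synonym monom4 = "var \<Rightarrow>\<^sub>0 nat"
type_synonym poly4 = "monom4 \<Rightarrow>\<^sub>0 complex"

definition Var :: "var \<Rightarrow> poly4" where
  "Var v = Poly_Mapping.single (Poly_Mapping.single v 1) 1"

definition scale4 :: "complex \<Rightarrow> poly4 \<Rightarrow> poly4" where
  "scale4 c f = Poly_Mapping.single 0 c * f"

definition total_degree :: "monom4 \<Rightarrow> nat" where
  "total_degree m = (\<Sum>v\<in>{X, Y, Z, W}. Poly_Mapping.lookup m v)"

definition homogeneous :: "nat \<Rightarrow> poly4 set" where
  "homogeneous N = {f. \<forall>m\<in>Poly_Mapping.keys f. total_degree m = N}"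

text \<open>
  If \<open>v\<close> does not occur in \<open>m\<close>, the truncated subtraction of exponents is harmless, since the
  coefficient is then \<open>0\<close>.
\<close>

definition D :: "var \<Rightarrow> poly4 \<Rightarrow> poly4" where
  "D v f = (\<Sum>m\<in>Poly_Mapping.keys f.
      Poly_Mapping.single (m - Poly_Mapping.single v 1)
        (of_nat (Poly_Mapping.lookup m v) * Poly_Mapping.lookup f m))"

definition L1 :: "poly4 \<Rightarrow> poly4" where "L1 f = D X (D Y f) - D Z (D W f)"
definition L2 :: "poly4 \<Rightarrow> poly4" where "L2 f = D X (D Z f) - D W (D Y f)"
definition L3 :: "poly4 \<Rightarrow> poly4" where "L3 f = D X (D W f) - D Y (D Z f)"

definition R1 :: "poly4 \<Rightarrow> poly4" where "R1 f = (Var X * Var Y - Var Z * Var W) * f"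
definition R2 :: "poly4 \<Rightarrow> poly4" where "R2 f = (Var X * Var Z - Var W * Var Y) * f"
definition R3 :: "poly4 \<Rightarrow> poly4" where "R3 f = (Var X * Var W - Var Y * Var Z) * f"

text \<open>Only the indices \<open>1, 2, 3\<close> are meaningful.\<close>

definition L :: "nat \<Rightarrow> poly4 \<Rightarrow> poly4" where
  "L i = (if i = 1 then L1 else if i = 2 then L2 else L3)"

definition R :: "nat \<Rightarrow> poly4 \<Rightarrow> poly4" where
  "R i = (if i = 1 then R1 else if i = 2 then R2 else R3)"

definition Ker :: "(poly4 \<Rightarrow> poly4) \<Rightarrow> poly4 set" where
  "Ker T = {f. T f = 0}"

text \<open>
  Sums of a possibly infinite family \<open>S\<close> of subspaces: the map \<open>family_sum\<close> from the
  external direct sum \<open>families S\<close> (finitely supported choices of elements of the \<open>S i\<close>) has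
  image the sum of the subspaces, and the sum is direct if this map is injective.
\<close>

definition families :: "('i \<Rightarrow> 'a::comm_monoid_add set) \<Rightarrow> ('i \<Rightarrow>\<^sub>0 'a) set" where
  "families S = {g. \<forall>i. Poly_Mapping.lookup g i \<in> S i}"

definition family_sum :: "('i \<Rightarrow>\<^sub>0 'a::comm_monoid_add) \<Rightarrow> 'a" where
  "family_sum g = (\<Sum>i\<in>Poly_Mapping.keys g. Poly_Mapping.lookup g i)"

definition subspace_sum :: "('i \<Rightarrow> 'a::comm_monoid_add set) \<Rightarrow> 'a set" where
  "subspace_sum S = family_sum ` families S"

definition direct :: "('i \<Rightarrow> 'a::comm_monoid_add set) \<Rightarrow> bool" where
  "direct S \<longleftrightarrow> inj_on family_sum (families S)"

lemma lookup_scale4: "Poly_Mapping.lookup (scale4 c f) m = c * Poly_Mapping.lookup f m"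
proof -
  have "scale4 c f = Poly_Mapping.map ((*) c) f"
    by (simp add: scale4_def mult_map_scale_conv_mult)
  then show ?thesis by (simp add: Poly_Mapping.map.rep_eq when_def)
qed

interpretation poly4: vector_space scale4
  by unfold_locales
    (rule poly_mapping_eqI; simp add: lookup_scale4 lookup_add algebra_simps)+

lemma lookup_D:
  "Poly_Mapping.lookup (D v f) m =
     of_nat (Poly_Mapping.lookup m v + 1) * Poly_Mapping.lookup f (m + Poly_Mapping.single v 1)"
proof -
  let ?e = "Poly_Mapping.single v (1::nat)"
  let ?t = "\<lambda>k. of_nat (Poly_Mapping.lookup k v) * Poly_Mapping.lookup f k :: complex"
  have shift: "k = m + ?e" if "k - ?e = m" "Poly_Mapping.lookup k v \<noteq> 0" for k
  proof (rule poly_mapping_eqI)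
    fix u
    show "Poly_Mapping.lookup k u = Poly_Mapping.lookup (m + ?e) u"
      using that by (auto simp: lookup_add lookup_minus lookup_single when_def)
  qed
  have "Poly_Mapping.lookup (D v f) m =
      (\<Sum>k\<in>Poly_Mapping.keys f. if k - ?e = m then ?t k else 0)"
    by (simp add: D_def lookup_sum lookup_single when_def)
  also have "\<dots> = (\<Sum>k\<in>Poly_Mapping.keys f. if k = m + ?e then ?t k else 0)"
  proof (rule sum.cong[OF refl])
    fix k
    have "?t k = 0 \<or> (k - ?e = m \<longleftrightarrow> k = m + ?e)"
      using shift by (metis add_diff_cancel_right' mult_zero_left of_nat_0)
    then show "(if k - ?e = m then ?t k else 0) = (if k = m + ?e then ?t k else 0)"
      by (elim disjE) simp_all
  qed
  also have "\<dots> = ?t (m + ?e)"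
    by (auto simp add: in_keys_iff)
  finally show ?thesis by (simp add: lookup_add)
qed

lemma D_add: "D v (f + g) = D v f + D v g"
  by (rule poly_mapping_eqI) (simp add: lookup_D lookup_add distrib_left)

lemma D_scale: "D v (scale4 c f) = scale4 c (D v f)"
  by (rule poly_mapping_eqI) (simp add: lookup_D lookup_scale4 mult.left_commute)

lemma linear4I:
  assumes "\<And>f g. T (f + g) = T f + T g" and "\<And>c f. T (scale4 c f) = scale4 c (T f)"
  shows "Vector_Spaces.linear scale4 scale4 T"
  by (intro Vector_Spaces.linear.intro module_hom.intro module_hom_axioms.intro
      poly4.vector_space_axioms poly4.module_axioms assms)

lemma linear_L: "Vector_Spaces.linear scale4 scale4 (L i)"
  by (rule linear4I)
    (simp_all add: L_def L1_def L2_def L3_def D_add D_scale poly4.scale_right_diff_distrib)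

lemma linear_R: "Vector_Spaces.linear scale4 scale4 (R i)"
  by (rule linear4I)
    (simp_all add: R_def R1_def R2_def R3_def scale4_def distrib_left mult.left_commute)

lemma subspace_homogeneous: "poly4.subspace (homogeneous N)"
proof (rule poly4.subspaceI)
  show "0 \<in> homogeneous N" by (simp add: homogeneous_def)
  show "f + g \<in> homogeneous N" if "f \<in> homogeneous N" "g \<in> homogeneous N" for f g
    using that Poly_Mapping.keys_add[of f g] unfolding homogeneous_def by blast
  show "scale4 c f \<in> homogeneous N" if "f \<in> homogeneous N" for c f
    using that by (auto simp: homogeneous_def in_keys_iff lookup_scale4)
qed

lemma subspace_summand: "poly4.subspace ((R i ^^ l) ` (Ker (L i) \<inter> homogeneous N))"
proof -
  interpret l: Vector_Spaces.linear scale4 scale4 "L i" by (rule linear_L)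
  interpret r: Vector_Spaces.linear scale4 scale4 "R i" by (rule linear_R)
  show ?thesis
  proof (induction l)
    case 0
    have "poly4.subspace (Ker (L i))"
      unfolding Ker_def by (rule l.subspace_kernel)
    then show ?case by (simp add: poly4.subspace_inter subspace_homogeneous)
  next
    case (Suc l)
    have "(R i ^^ Suc l) ` A = R i ` ((R i ^^ l) ` A)" for A
      by (simp add: image_comp)
    then show ?case using r.subspace_image[OF Suc.IH] by simp
  qed
qed

end

theory Submission
  imports Defs
begin

text \<open>
  For \<open>i = 1, 2, 3\<close> the operators are \<open>L = D\<^sub>a D\<^sub>b - D\<^sub>c D\<^sub>d\<close> and multiplication \<open>R\<close> by \<open>ab - cd\<close>,
  with \<open>a, b, c, d\<close> a permutation of the variables. By Euler's identity \<open>L R - R L = N + 2\<close> on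
  \<open>P\<^sub>N\<close>, so for \<open>h \<in> Ker L \<inter> P\<^sub>N\<close> the element \<open>L (R\<^sup>l\<^sup>+\<^sup>1 h)\<close> is \<open>(l + 1)(N + l + 2) R\<^sup>l h\<close>, and
  \<open>L\<^sup>l R\<^sup>l h\<close> is a nonzero multiple of \<open>h\<close>. Existence: if \<open>f \<in> P\<^sub>N\<close> and \<open>L\<^sup>k\<^sup>+\<^sup>1 f = 0\<close>, then subtracting
  a multiple of \<open>R\<^sup>k L\<^sup>k f\<close> from \<open>f\<close> gives an element killed by \<open>L\<^sup>k\<close>. Directness: the power \<open>L\<^sup>l\<close>
  with \<open>l\<close> maximal in a relation kills all terms except those of level \<open>l\<close>, and these become
  elements of distinct degrees.
\<close>

section \<open>Sums of families\<close>

lemma family_sum_superset: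
  assumes "finite A" "Poly_Mapping.keys g \<subseteq> A"
  shows "family_sum g = (\<Sum>i\<in>A. Poly_Mapping.lookup g i)"
  unfolding family_sum_def
  by (rule sum.mono_neutral_left) (use assms in \<open>auto simp: in_keys_iff\<close>)

lemma family_sum_add: "family_sum (g + h) = family_sum g + family_sum h"
proof -
  let ?A = "Poly_Mapping.keys g \<union> Poly_Mapping.keys h"
  have "Poly_Mapping.keys (g + h) \<subseteq> ?A" by (rule Poly_Mapping.keys_add)
  then show ?thesis
    by (simp add: family_sum_superset[of ?A] lookup_add sum.distrib)
qed

lemma family_sum_diff:
  fixes g h :: "'i \<Rightarrow>\<^sub>0 'a::ab_group_add"
  shows "family_sum (g - h) = family_sum g - family_sum h"
  using family_sum_add[of "g - h" h] by simp

lemma family_sum_single: "family_sum (Poly_Mapping.single i u) = u"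
  by (simp add: family_sum_superset[of "{i}"])

lemma subspace_sum_add:
  assumes "\<And>i. poly4.subspace (S i)" "f \<in> subspace_sum S" "g \<in> subspace_sum S"
  shows "f + g \<in> subspace_sum S"
proof -
  obtain f' g' where "f' \<in> families S" "g' \<in> families S" "f = family_sum f'" "g = family_sum g'"
    using assms(2,3) by (auto simp: subspace_sum_def)
  moreover from this have "f' + g' \<in> families S"
    using assms(1) by (auto simp: families_def lookup_add poly4.subspace_add)
  ultimately show ?thesis
    unfolding subspace_sum_def by (metis family_sum_add imageI)
qed

lemma subspace_sum_member:
  assumes "\<And>i. poly4.subspace (S i)" "u \<in> S i"
  shows "u \<in> subspace_sum S"
proof -
  have "Poly_Mapping.single i u \<in> families S"
    using assms by (auto simp: families_def lookup_single when_def poly4.subspace_0)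
  then show ?thesis
    unfolding subspace_sum_def by (metis family_sum_single imageI)
qed

text \<open>\<open>family_sum\<close> is additive and families in subspaces are closed under
  differences, so injectivity reduces to a trivial kernel.\<close>

lemma directI:
  fixes S :: "'i \<Rightarrow> poly4 set"
  assumes S: "\<And>i. poly4.subspace (S i)"
    and zero: "\<And>g. g \<in> families S \<Longrightarrow> family_sum g = 0 \<Longrightarrow> g = 0"
  shows "direct S"
  unfolding direct_def
proof (rule inj_onI)
  fix g h assume "g \<in> families S" "h \<in> families S" "family_sum g = family_sum h"
  then have "g - h \<in> families S" "family_sum (g - h) = 0"
    using S by (auto simp: families_def lookup_minus family_sum_diff poly4.subspace_diff)
  then show "g = h" using zero by fastforce
qed

lemma poly_mapping_induct [case_names zero single add]:
  fixes f :: "'k \<Rightarrow>\<^sub>0 'a::comm_monoid_add"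
  assumes zero: "P 0"
    and single: "\<And>k c. P (Poly_Mapping.single k c)"
    and add: "\<And>f g. P f \<Longrightarrow> P g \<Longrightarrow> P (f + g)"
  shows "P f"
proof -
  \<comment> \<open>A sum over an infinite \<open>K\<close> is \<open>0\<close> by convention, which
    \<open>zero\<close> covers.\<close>
  have "P (\<Sum>k\<in>K. Poly_Mapping.single k (Poly_Mapping.lookup f k))" for K
    by (induction K rule: infinite_finite_induct) (auto intro: assms)
  moreover have "(\<Sum>k\<in>Poly_Mapping.keys f. Poly_Mapping.single k (Poly_Mapping.lookup f k)) = f"
    by (rule poly_mapping_eqI) (auto simp: lookup_sum lookup_single when_def in_keys_iff)
  ultimately show ?thesis by metis
qed

section \<open>Derivatives and degrees\<close>

lemma D_0: "D v 0 = 0"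
  by (simp add: D_def)

lemma D_diff: "D v (f - g) = D v f - D v g"
  using D_add[of v "f - g" g] by simp

lemma lookup_Var_mult:
  "Poly_Mapping.lookup (Var v * f) m =
    (if Poly_Mapping.lookup m v = 0 then 0
     else Poly_Mapping.lookup f (m - Poly_Mapping.single v 1))"
proof (induction f rule: poly_mapping_induct)
  case (single k c)
  let ?e = "Poly_Mapping.single v (1::nat)"
  have "?e + k = m \<longleftrightarrow> Poly_Mapping.lookup m v \<noteq> 0 \<and> k = m - ?e"
    by (auto simp: poly_mapping_eq_iff fun_eq_iff lookup_add lookup_minus lookup_single when_def)
  then show ?case
    by (auto simp: Var_def mult_single lookup_single when_def)
next
  case zero
  then show ?case by simp
next
  case (add f g)
  then show ?case by (simp add: distrib_left lookup_add)
qed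

text \<open>Monomials are eigenvectors of \<open>Var v * D v\<close>; summing over the four
  variables will give Euler's identity.\<close>

lemma lookup_Var_mult_D:
  "Poly_Mapping.lookup (Var v * D v f) m =
    of_nat (Poly_Mapping.lookup m v) * Poly_Mapping.lookup f m"
proof -
  have "Poly_Mapping.lookup m v \<noteq> 0 \<Longrightarrow>
      m - Poly_Mapping.single v 1 + Poly_Mapping.single v 1 = m"
    by (auto simp: poly_mapping_eq_iff fun_eq_iff lookup_add lookup_minus lookup_single when_def)
  then show ?thesis
    by (auto simp: lookup_Var_mult lookup_D lookup_minus)
qed

text \<open>Leibniz rule with a variable as one factor: the Weyl algebra relations that yield the
  commutator of \<open>lap\<close> and \<open>quad\<close>.\<close>

lemma D_Var_mult: "D v (Var u * f) = (if u = v then f else 0) + Var u * D v f"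
proof (rule poly_mapping_eqI)
  fix m :: monom4
  let ?ev = "Poly_Mapping.single v (1::nat)" and ?eu = "Poly_Mapping.single u (1::nat)"
  show "Poly_Mapping.lookup (D v (Var u * f)) m =
      Poly_Mapping.lookup ((if u = v then f else 0) + Var u * D v f) m"
  proof (cases "u = v")
    case True
    then show ?thesis
      unfolding lookup_add lookup_D[of v "Var u * f"]
      by (simp add: lookup_Var_mult_D lookup_Var_mult[of v f] lookup_add distrib_right
          del: One_nat_def)
  next
    case False
    then have "m + ?ev - ?eu = m - ?eu + ?ev" if "Poly_Mapping.lookup m u \<noteq> 0"
      using that
      by (auto simp: poly_mapping_eq_iff fun_eq_iff lookup_add lookup_minus lookup_single when_def)
    with False show ?thesis
      by (simp add: lookup_D lookup_Var_mult lookup_add lookup_minus lookup_single del: One_nat_def)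
  qed
qed

lemma homogeneousI:
  assumes "\<And>m. Poly_Mapping.lookup f m \<noteq> 0 \<Longrightarrow> total_degree m = N"
  shows "f \<in> homogeneous N"
  using assms by (auto simp: homogeneous_def in_keys_iff)

lemma homogeneousD:
  assumes "f \<in> homogeneous N" "Poly_Mapping.lookup f m \<noteq> 0"
  shows "total_degree m = N"
  using assms by (auto simp: homogeneous_def in_keys_iff)

lemma total_degree_add: "total_degree (m + n) = total_degree m + total_degree n"
  by (simp add: total_degree_def lookup_add)

lemma total_degree_single: "total_degree (Poly_Mapping.single v k) = k"
  by (cases v) (simp_all add: total_degree_def lookup_single)

text \<open>The truncated \<open>N - 1\<close> is harmless: for \<open>N = 0\<close> the derivative
  vanishes, and zero is homogeneous of every degree.\<close>

lemma D_homogeneous: "f \<in> homogeneous N \<Longrightarrow> D v f \<in> homogeneous (N - 1)"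
  by (rule homogeneousI)
    (auto simp: lookup_D total_degree_add total_degree_single dest!: homogeneousD)

lemma D_homogeneous_0:
  assumes "f \<in> homogeneous 0"
  shows "D v f = 0"
proof (rule poly_mapping_eqI)
  fix m
  have "total_degree (m + Poly_Mapping.single v 1) \<noteq> 0"
    by (simp add: total_degree_add total_degree_single)
  then show "Poly_Mapping.lookup (D v f) m = Poly_Mapping.lookup 0 m"
    using homogeneousD[OF assms] by (auto simp: lookup_D)
qed

lemma Var_mult_homogeneous:
  assumes "f \<in> homogeneous N"
  shows "Var v * f \<in> homogeneous (Suc N)"
proof (rule homogeneousI)
  fix m assume *: "Poly_Mapping.lookup (Var v * f) m \<noteq> 0"
  let ?e = "Poly_Mapping.single v (1::nat)"
  from * have "Poly_Mapping.lookup m v \<noteq> 0" "Poly_Mapping.lookup f (m - ?e) \<noteq> 0"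
    by (auto simp: lookup_Var_mult split: if_splits)
  moreover from this have "m - ?e + ?e = m"
    by (auto simp: poly_mapping_eq_iff fun_eq_iff lookup_add lookup_minus lookup_single when_def)
  ultimately show "total_degree m = Suc N"
    using homogeneousD[OF assms] total_degree_add[of "m - ?e" ?e]
    by (simp add: total_degree_single)
qed

section \<open>The operators of a nondegenerate quadric\<close>

text \<open>As \<open>var\<close> has four elements, \<open>a\<close>, \<open>b\<close>,
  \<open>c\<close>, \<open>d\<close> exhaust it, and the three values of \<open>i\<close> are three
  orderings of the same variables.\<close>

locale quadric =
  fixes a b c d :: var
  assumes distinct: "distinct [a, b, c, d]"
begin

definition lap :: "poly4 \<Rightarrow> poly4" where
  "lap f = D a (D b f) - D c (D d f)"

definition quad :: "poly4 \<Rightarrow> poly4" where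
  "quad f = (Var a * Var b - Var c * Var d) * f"

lemma vars_eq: "{X, Y, Z, W} = {a, b, c, d}"
proof (rule sym, rule card_subset_eq)
  show "{a, b, c, d} \<subseteq> {X, Y, Z, W}"
    using var.exhaust by blast
  show "card {a, b, c, d} = card {X, Y, Z, W}"
    using distinct by simp
qed simp

lemma euler:
  assumes "f \<in> homogeneous N"
  shows "Var a * D a f + Var b * D b f + Var c * D c f + Var d * D d f = scale4 (of_nat N) f"
proof (rule poly_mapping_eqI)
  fix m
  have "total_degree m = Poly_Mapping.lookup m a + Poly_Mapping.lookup m b +
      Poly_Mapping.lookup m c + Poly_Mapping.lookup m d"
    using distinct by (simp add: total_degree_def vars_eq)
  then show "Poly_Mapping.lookup
        (Var a * D a f + Var b * D b f + Var c * D c f + Var d * D d f) m =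
      Poly_Mapping.lookup (scale4 (of_nat N) f) m"
    using homogeneousD[OF assms, of m]
    by (cases "Poly_Mapping.lookup f m = 0")
      (auto simp: lookup_add lookup_Var_mult_D lookup_scale4 algebra_simps)
qed

text \<open>Commuting \<open>D a\<close>, \<open>D b\<close> past \<open>Var a * Var b\<close>
  leaves \<open>f\<close> plus two Euler terms; the pair \<open>c\<close>, \<open>d\<close> does the
  same, its two minus signs cancelling. The mixed terms commute.\<close>

lemma lap_quad:
  assumes "f \<in> homogeneous N"
  shows "lap (quad f) = quad (lap f) + scale4 (of_nat (N + 2)) f"
proof -
  have ne: "a \<noteq> b" "a \<noteq> c" "a \<noteq> d" "b \<noteq> c" "b \<noteq> d" "c \<noteq> d"
    using distinct by auto
  have quad_f: "quad f = Var a * (Var b * f) - Var c * (Var d * f)"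
    by (simp add: quad_def algebra_simps)
  have "lap (quad f) = quad (lap f) +
      (Var a * D a f + Var b * D b f + Var c * D c f + Var d * D d f) + f + f"
    unfolding quad_f
    using ne ne[symmetric]
    by (simp add: lap_def D_diff D_add D_Var_mult D_0) (simp add: quad_def algebra_simps)
  \<comment> \<open>The form \<open>N + 1 + 1\<close> lets distributivity split off the two copies
    of \<open>f\<close>.\<close>
  also have "\<dots> = quad (lap f) + scale4 (of_nat N + 1 + 1) f"
    unfolding euler[OF assms] poly4.scale_left_distrib by (simp add: add.assoc)
  finally show ?thesis by (simp add: add.commute)
qed

section \<open>Linearity, degree shifts and local nilpotency\<close>

lemma quad_scale: "quad (scale4 k f) = scale4 k (quad f)"
  by (simp add: quad_def scale4_def ac_simps)

lemma lap_scale: "lap (scale4 k f) = scale4 k (lap f)"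
  by (simp add: lap_def D_scale poly4.scale_right_diff_distrib)

lemma quad_0: "quad 0 = 0"
  by (simp add: quad_def)

lemma lap_0: "lap 0 = 0"
  by (simp add: lap_def D_0)

lemma lap_add: "lap (f + g) = lap f + lap g"
  by (simp add: lap_def D_add)

lemma lap_diff: "lap (f - g) = lap f - lap g"
  by (simp add: lap_def D_diff)

lemma lap_pow_0: "(lap ^^ k) 0 = 0"
  by (induction k) (simp_all add: lap_0)

lemma lap_pow_diff: "(lap ^^ k) (f - g) = (lap ^^ k) f - (lap ^^ k) g"
  by (induction k) (simp_all add: lap_diff)

lemma lap_pow_scale: "(lap ^^ k) (scale4 r f) = scale4 r ((lap ^^ k) f)"
  by (induction k) (simp_all add: lap_scale)

lemma lap_pow_sum: "(lap ^^ k) (\<Sum>i\<in>A. f i) = (\<Sum>i\<in>A. (lap ^^ k) (f i))"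
proof -
  have "(lap ^^ k) (f + g) = (lap ^^ k) f + (lap ^^ k) g" for f g
    by (induction k) (simp_all add: lap_add)
  then show ?thesis
    by (induction A rule: infinite_finite_induct) (simp_all add: lap_pow_0)
qed

lemma lap_homogeneous: "f \<in> homogeneous N \<Longrightarrow> lap f \<in> homogeneous (N - 2)"
  using poly4.subspace_diff[OF subspace_homogeneous]
    D_homogeneous[OF D_homogeneous] by (simp add: lap_def numeral_2_eq_2)

lemma lap_pow_homogeneous: "f \<in> homogeneous N \<Longrightarrow> (lap ^^ k) f \<in> homogeneous (N - 2 * k)"
proof (induction k)
  case (Suc k)
  then show ?case using lap_homogeneous[of "(lap ^^ k) f" "N - 2 * k"] by simp
qed simp

text \<open>Each application lowers the degree by 2, and below degree 2 two derivatives give zero.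
  This starts the existence induction.\<close>

lemma lap_pow_eq_0: "f \<in> homogeneous N \<Longrightarrow> N < 2 * k \<Longrightarrow> (lap ^^ k) f = 0"
proof (induction k arbitrary: f N)
  case (Suc k)
  show ?case
  proof (cases "N < 2")
    case True
    then have "N - 1 = 0" by simp
    then have "D v f \<in> homogeneous 0" for v
      using D_homogeneous[OF Suc.prems(1), of v] by metis
    then have "lap f = 0"
      by (simp add: lap_def D_homogeneous_0)
    then show ?thesis by (simp add: funpow_swap1 lap_pow_0)
  next
    case False
    then show ?thesis
      using Suc.IH[OF lap_homogeneous[OF Suc.prems(1)]] Suc.prems(2) by (simp add: funpow_swap1)
  qed
qed simp

lemma quad_homogeneous: "f \<in> homogeneous N \<Longrightarrow> quad f \<in> homogeneous (N + 2)"
  using poly4.subspace_diff[OF subspace_homogeneous]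
    Var_mult_homogeneous[OF Var_mult_homogeneous] by (simp add: quad_def left_diff_distrib mult.assoc)

lemma quad_pow_homogeneous: "f \<in> homogeneous N \<Longrightarrow> (quad ^^ k) f \<in> homogeneous (N + 2 * k)"
proof (induction k)
  case (Suc k)
  then show ?case using quad_homogeneous[of "(quad ^^ k) f" "N + 2 * k"] by simp
qed simp

section \<open>Lowering the powers of \<open>quad\<close> over the kernel of
  \<open>lap\<close>\<close>

text \<open>Passing \<open>lap\<close> through one \<open>quad\<close> adds the degree at that place
  plus 2; the factor is the sum of \<open>N + 2 * j + 2\<close> for \<open>j\<close> from 0 to
  \<open>l\<close>.\<close>

lemma lap_quad_pow:
  assumes "h \<in> Ker lap \<inter> homogeneous N"
  shows "lap ((quad ^^ Suc l) h) = scale4 (of_nat (Suc l * (N + l + 2))) ((quad ^^ l) h)"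
proof (induction l)
  case 0
  then show ?case
    using assms lap_quad[of h N] by (simp add: Ker_def quad_0)
next
  case (Suc l)
  let ?u = "(quad ^^ Suc l) h"
  have "lap (quad ?u) = quad (lap ?u) + scale4 (of_nat (N + 2 * Suc l + 2)) ?u"
    using assms by (intro lap_quad quad_pow_homogeneous) simp
  also have "\<dots> = scale4 (of_nat (Suc l * (N + l + 2)) + of_nat (N + 2 * Suc l + 2)) ?u"
    unfolding Suc.IH quad_scale poly4.scale_left_distrib by simp
  also have "of_nat (Suc l * (N + l + 2)) + of_nat (N + 2 * Suc l + 2)
      = (of_nat (Suc (Suc l) * (N + Suc l + 2)) :: complex)"
    unfolding of_nat_add[symmetric] by (simp add: algebra_simps)
  finally show ?case by simp
qed

text \<open>The scalar is the product of \<open>j * (N + j + 1)\<close> for \<open>j\<close> from 1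
  to \<open>l\<close>, nonzero in characteristic 0.\<close>

lemma lap_pow_quad_pow:
  assumes "h \<in> Ker lap \<inter> homogeneous N"
  shows "\<exists>r. r \<noteq> 0 \<and> (lap ^^ l) ((quad ^^ l) h) = scale4 r h"
proof (induction l)
  case 0
  show ?case by (rule exI[of _ 1]) simp
next
  case (Suc l)
  then obtain r where r: "r \<noteq> 0" "(lap ^^ l) ((quad ^^ l) h) = scale4 r h" by blast
  let ?s = "of_nat (Suc l * (N + l + 2)) :: complex"
  have "(lap ^^ Suc l) ((quad ^^ Suc l) h) = (lap ^^ l) (lap ((quad ^^ Suc l) h))"
    by (simp only: funpow_Suc_right o_apply)
  also have "\<dots> = scale4 (?s * r) h"
    unfolding lap_quad_pow[OF assms] lap_pow_scale r(2) by simp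
  finally have "(lap ^^ Suc l) ((quad ^^ Suc l) h) = scale4 (?s * r) h" .
  moreover have "?s * r \<noteq> 0"
    using r(1) by (simp only: mult_eq_0_iff of_nat_eq_0_iff) simp
  ultimately show ?case by blast
qed

section \<open>Existence and directness of the decomposition\<close>

definition summand :: "nat \<times> nat \<Rightarrow> poly4 set" where
  "summand = (\<lambda>(N, l). (quad ^^ l) ` (Ker lap \<inter> homogeneous N))"

text \<open>Up to a nonzero scalar, \<open>(lap ^^ l) u\<close> is the kernel element
  \<open>h\<close> from which \<open>u\<close> arises; all three claims are read off from
  \<open>h\<close>.\<close>

lemma
  assumes "u \<in> summand (N, l)"
  shows lap_pow_summand_homogeneous: "(lap ^^ l) u \<in> homogeneous N"
    and lap_pow_summand_eq_0: "l < k \<Longrightarrow> (lap ^^ k) u = 0"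
    and lap_pow_summand_neq_0: "u \<noteq> 0 \<Longrightarrow> (lap ^^ l) u \<noteq> 0"
proof -
  obtain h where h: "h \<in> Ker lap \<inter> homogeneous N" "u = (quad ^^ l) h"
    using assms by (auto simp: summand_def)
  obtain r where r: "r \<noteq> 0" "(lap ^^ l) u = scale4 r h"
    using lap_pow_quad_pow[OF h(1)] h(2) by blast
  show "(lap ^^ l) u \<in> homogeneous N"
    using h(1) by (simp add: r(2) poly4.subspace_scale[OF subspace_homogeneous])
  show "(lap ^^ k) u = 0" if "l < k"
  proof -
    obtain j where "k = j + Suc l" using \<open>l < k\<close> less_imp_Suc_add[of l k] by (auto simp: ac_simps)
    then have "(lap ^^ k) u = (lap ^^ j) (lap ((lap ^^ l) u))"
      by (simp add: funpow_add del: add_Suc_right)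
    then show ?thesis using h(1) by (simp add: r(2) lap_scale Ker_def lap_pow_0)
  qed
  show "(lap ^^ l) u \<noteq> 0" if "u \<noteq> 0"
  proof
    have "(quad ^^ l) 0 = 0" by (induction l) (simp_all add: quad_0)
    moreover assume "(lap ^^ l) u = 0"
    ultimately show False using that r h(2) by (simp add: poly4.scale_eq_0_iff)
  qed
qed

lemma homogeneous_in_subspace_sum:
  assumes S: "\<And>p. poly4.subspace (summand p)"
  shows "f \<in> homogeneous N \<Longrightarrow> (lap ^^ k) f = 0 \<Longrightarrow> f \<in> subspace_sum summand"
proof (induction k arbitrary: f)
  case 0
  then show ?case
    using subspace_sum_member[OF S poly4.subspace_0[OF S]] by simp
next
  case (Suc k)
  let ?h = "(lap ^^ k) f"
  show ?case
  proof (cases "N < 2 * k")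
    case True
    then show ?thesis using Suc.IH lap_pow_eq_0 Suc.prems by blast
  next
    case False
    \<comment> \<open>Here \<open>2 * k \<le> N\<close>, so \<open>N - 2 * k\<close> is exact and
      \<open>quad ^^ k\<close> brings \<open>?h\<close> back to degree \<open>N\<close>.\<close>
    have h: "?h \<in> Ker lap \<inter> homogeneous (N - 2 * k)"
      using Suc.prems lap_pow_homogeneous by (simp add: Ker_def)
    obtain r where r: "r \<noteq> 0" "(lap ^^ k) ((quad ^^ k) ?h) = scale4 r ?h"
      using lap_pow_quad_pow[OF h] by blast
    \<comment> \<open>The factor \<open>inverse r\<close> makes \<open>(lap ^^ k) ?u\<close> equal
      to \<open>?h\<close>, so the induction hypothesis applies to \<open>f - ?u\<close>.\<close>
    let ?u = "scale4 (inverse r) ((quad ^^ k) ?h)"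
    have "(quad ^^ k) ?h \<in> summand (N - 2 * k, k)"
      using h by (auto simp: summand_def)
    then have "?u \<in> subspace_sum summand"
      using subspace_sum_member[where S = summand, OF S poly4.subspace_scale[OF S]] by blast
    moreover have "?u \<in> homogeneous N"
      using quad_pow_homogeneous[of ?h "N - 2 * k" k] h False
      by (simp add: poly4.subspace_scale[OF subspace_homogeneous])
    then have "f - ?u \<in> homogeneous N"
      using Suc.prems(1) by (simp add: poly4.subspace_diff[OF subspace_homogeneous])
    moreover have "(lap ^^ k) (f - ?u) = 0"
      using r by (simp add: lap_pow_diff lap_pow_scale)
    ultimately have "?u + (f - ?u) \<in> subspace_sum summand"
      using Suc.IH subspace_sum_add[where S = summand, OF S] by blast
    then show ?thesis by simp
  qed
qed

text \<open>The sum is closed under addition, so single terms suffice; these are homogeneous and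
  killed by a power of \<open>lap\<close>.\<close>

lemma subspace_sum_summand:
  assumes S: "\<And>p. poly4.subspace (summand p)"
  shows "f \<in> subspace_sum summand"
proof (induction f rule: poly_mapping_induct)
  case zero
  show ?case using subspace_sum_member[OF S poly4.subspace_0[OF S]] .
next
  case (single m c)
  have "Poly_Mapping.single m c \<in> homogeneous (total_degree m)"
    by (auto simp: homogeneous_def)
  moreover from this have "(lap ^^ Suc (total_degree m)) (Poly_Mapping.single m c) = 0"
    by (rule lap_pow_eq_0) simp
  ultimately show ?case by (rule homogeneous_in_subspace_sum[OF S])
next
  case (add f g)
  then show ?case using subspace_sum_add[where S = summand, OF S] by blast
qed

lemma direct_summand:
  assumes S: "\<And>p. poly4.subspace (summand p)"
  shows "direct summand"
proof (rule directI[OF S], rule ccontr)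
  fix g assume g: "g \<in> families summand" "family_sum g = 0" "g \<noteq> 0"
  let ?K = "Poly_Mapping.keys g" and ?g = "Poly_Mapping.lookup g"
  define M where "M = Max (snd ` ?K)"
  have "?K \<noteq> {}" using g(3) by simp
  then have "M \<in> snd ` ?K" unfolding M_def by (intro Max_in) auto
  then obtain N where N: "(N, M) \<in> ?K" by auto
  have mem: "?g (N', l) \<in> summand (N', l)" for N' l
    using g(1) by (simp add: families_def)
  have "(lap ^^ M) (?g (N, M)) \<noteq> 0"
    using N lap_pow_summand_neq_0[OF mem] by (simp add: in_keys_iff)
  then obtain m where m: "Poly_Mapping.lookup ((lap ^^ M) (?g (N, M))) m \<noteq> 0"
    by (metis poly_mapping_eqI lookup_zero)
  then have deg: "total_degree m = N"
    using homogeneousD[OF lap_pow_summand_homogeneous[OF mem]] by blast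
  \<comment> \<open>Lower levels die under \<open>lap ^^ M\<close>, and the other terms of level
    \<open>M\<close> land in degrees different from that of \<open>m\<close>; the coefficient at
    \<open>m\<close> isolates \<open>(N, M)\<close>.\<close>
  have "Poly_Mapping.lookup ((lap ^^ M) (?g p)) m = 0" if p: "p \<in> ?K - {(N, M)}" for p
  proof (cases p)
    case (Pair N' l)
    have "l \<le> M" using p Pair unfolding M_def by (force intro: Max_ge)
    then consider "l < M" | "l = M" "N' \<noteq> N" using p Pair by force
    then show ?thesis
    proof cases
      case 1
      then show ?thesis using lap_pow_summand_eq_0[OF mem] Pair by simp
    next
      case 2
      then show ?thesis
        using homogeneousD[OF lap_pow_summand_homogeneous[OF mem]] deg Pair by blast
    qed
  qed
  moreover have "(\<Sum>p\<in>?K. Poly_Mapping.lookup ((lap ^^ M) (?g p)) m) = 0"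
    using g(2) by (simp add: family_sum_def lap_pow_0 flip: lookup_sum lap_pow_sum)
  ultimately have "Poly_Mapping.lookup ((lap ^^ M) (?g (N, M))) m = 0"
    using N by (simp add: sum.remove)
  then show False using m by contradiction
qed

end

theorem proposition12p23:
  fixes i :: nat
  assumes "i \<in> {1, 2, 3}"
  shows "(UNIV :: poly4 set) = subspace_sum (\<lambda>(N, l). (R i ^^ l) ` (Ker (L i) \<inter> homogeneous N))
    \<and> direct (\<lambda>(N, l). (R i ^^ l) ` (Ker (L i) \<inter> homogeneous N))"
proof -
  \<comment> \<open>The variables come in the order in which \<open>L1\<close>, \<open>L2\<close>,
    \<open>L3\<close> use them, so \<open>lap\<close> and \<open>quad\<close> unfold to the given
    operators.\<close>
  interpret q1: quadric X Y Z W by unfold_locales simp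
  interpret q2: quadric X Z W Y by unfold_locales simp
  interpret q3: quadric X W Y Z by unfold_locales simp
  let ?S = "\<lambda>(N, l). (R i ^^ l) ` (Ker (L i) \<inter> homogeneous N)"
  have S: "poly4.subspace (?S p)" for p
    using subspace_summand by (cases p) simp
  consider "i = 1" | "i = 2" | "i = 3" using assms by auto
  then show ?thesis
  proof cases
    case 1
    then have "L i = q1.lap" "R i = q1.quad"
      by (auto simp: fun_eq_iff L_def L1_def R_def R1_def q1.lap_def q1.quad_def)
    then have "?S = q1.summand" by (simp add: q1.summand_def)
    then show ?thesis
      using q1.subspace_sum_summand q1.direct_summand S by auto
  next
    case 2
    then have "L i = q2.lap" "R i = q2.quad"
      by (auto simp: fun_eq_iff L_def L2_def R_def R2_def q2.lap_def q2.quad_def)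
    then have "?S = q2.summand" by (simp add: q2.summand_def)
    then show ?thesis
      using q2.subspace_sum_summand q2.direct_summand S by auto
  next
    case 3
    then have "L i = q3.lap" "R i = q3.quad"
      by (auto simp: fun_eq_iff L_def L3_def R_def R3_def q3.lap_def q3.quad_def)
    then have "?S = q3.summand" by (simp add: q3.summand_def)
    then show ?thesis
      using q3.subspace_sum_summand q3.direct_summand S by auto
  qed
qed

end
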